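(* Let $K$ be a finite field, $G$ a finite group, $\alpha:G\times G\to K^*$ a 2-cocycle, and let $C$ be a nonzero twisted $G$-code, i.e. a nonzero right ideal of the twisted group algebra $K^\alpha G$. Then $$d(C)\cdot \dim_K C=|G|$$ if and only if there exist a subgroup $H\le G$ and an element $c\in K^\alpha H$ such that $|H|=d(C)$, $cK^\alpha H$ has dimension $1$ over $K$, and $C=cK^\alpha G$.
   Context: A 2-cocycle $\alpha:G\times G\to K^*$ (with trivial action of $G$ on $K$) satisfies $\alpha(x,y)\alpha(xy,z)=\alpha(y,z)\alpha(x,yz)$ and $\alpha(x,e)=\alpha(e,x)=1$ for all $x,y,z\in G$. The twisted group algebra $K^\alpha G$ is the $K$-vector space with basis $\{\overline{g}\mid g\in G\}$ and $K$-bilinear multiplication determined by $\overline{x}\cdot\overline{y}=\alpha(x,y)\overline{xy}$. For $H\le G$, $K^\alpha H$ denotes the subalgebra of $K^\alpha G$ spanned by $\{\overline{h}\mid h\in H\}$ (the twisted group algebra for the restriction of $\alpha$ to $H\times H$). For $f=\sum_{g\in G}f_g\overline{g}\in K^\alpha G$, $\mathrm{supp}(f)=\{g\in G\mid f_g\ne 0\}$ and the weight of $f$ is $|\mathrm{supp}(f)|$; the minimum distance $d(C)$ is the minimum weight of a nonzero element of $C$. *)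

theory Defs
  imports "HOL-Algebra.Algebra" "HOL-Library.Function_Algebras"
begin

definition two_cocycle :: "('g, 'm) monoid_scheme \<Rightarrow> ('g \<Rightarrow> 'g \<Rightarrow> 'k::field) \<Rightarrow> bool" where
  "two_cocycle G \<alpha> \<longleftrightarrow>
     (\<forall>x\<in>carrier G. \<forall>y\<in>carrier G. \<alpha> x y \<noteq> 0) \<and>
     (\<forall>x\<in>carrier G. \<forall>y\<in>carrier G. \<forall>z\<in>carrier G.
        \<alpha> x y * \<alpha> (x \<otimes>\<^bsub>G\<^esub> y) z = \<alpha> y z * \<alpha> x (y \<otimes>\<^bsub>G\<^esub> z)) \<and>
     (\<forall>x\<in>carrier G. \<alpha> x \<one>\<^bsub>G\<^esub> = 1 \<and> \<alpha> \<one>\<^bsub>G\<^esub> x = 1)"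

text \<open>Elements of the twisted group algebra are coefficient functions on \<^term>\<open>carrier G\<close>,
  extended by zero to the whole type.\<close>

definition fun_scale :: "'k::field \<Rightarrow> ('g \<Rightarrow> 'k) \<Rightarrow> 'g \<Rightarrow> 'k" where
  "fun_scale c f = (\<lambda>g. c * f g)"

global_interpretation fun_vs: vector_space "fun_scale :: 'k::field \<Rightarrow> ('g \<Rightarrow> 'k) \<Rightarrow> 'g \<Rightarrow> 'k"
  by unfold_locales (auto simp: fun_scale_def fun_eq_iff algebra_simps)

definition tbasis :: "'g \<Rightarrow> 'g \<Rightarrow> 'k::field" where
  "tbasis x = (\<lambda>g. if g = x then 1 else 0)"

definition tmult :: "('g, 'm) monoid_scheme \<Rightarrow> ('g \<Rightarrow> 'g \<Rightarrow> 'k::field) \<Rightarrow> ('g \<Rightarrow> 'k) \<Rightarrow> ('g \<Rightarrow> 'k) \<Rightarrow> 'g \<Rightarrow> 'k" where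
  "tmult G \<alpha> f h =
     (\<lambda>z. \<Sum>x\<in>carrier G. \<Sum>y\<in>carrier G. f x * h y * \<alpha> x y * tbasis (x \<otimes>\<^bsub>G\<^esub> y) z)"

definition twisted_group_algebra ::
    "('g, 'm) monoid_scheme \<Rightarrow> ('g \<Rightarrow> 'g \<Rightarrow> 'k::field) \<Rightarrow> ('g \<Rightarrow> 'k) ring" where
  "twisted_group_algebra G \<alpha> =
     \<lparr> carrier = {f. \<forall>g. g \<notin> carrier G \<longrightarrow> f g = 0},
       monoid.mult = tmult G \<alpha>, one = tbasis \<one>\<^bsub>G\<^esub>, ring.zero = 0, add = (+) \<rparr>"

definition twisted_subalgebra :: "'g set \<Rightarrow> ('g \<Rightarrow> 'k::field) set" where
  "twisted_subalgebra H = fun_vs.span (tbasis ` H)"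

definition right_ideal :: "'a set \<Rightarrow> ('a, 'm) ring_scheme \<Rightarrow> bool" where
  "right_ideal I R \<longleftrightarrow> additive_subgroup I R \<and> (\<forall>a\<in>I. \<forall>x\<in>carrier R. a \<otimes>\<^bsub>R\<^esub> x \<in> I)"

definition supp :: "('g, 'm) monoid_scheme \<Rightarrow> ('g \<Rightarrow> 'k::field) \<Rightarrow> 'g set" where
  "supp G f = {g \<in> carrier G. f g \<noteq> 0}"

definition min_dist :: "('g, 'm) monoid_scheme \<Rightarrow> ('g \<Rightarrow> 'k::field) set \<Rightarrow> nat" where
  "min_dist G C = Min {card (supp G f) |f. f \<in> C \<and> f \<noteq> 0}"

lemma twisted_subalgebra_eq:
  assumes "finite H"
  shows "twisted_subalgebra H = {f :: 'g \<Rightarrow> 'k::field. \<forall>g. g \<notin> H \<longrightarrow> f g = 0}"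
proof
  show "twisted_subalgebra H \<subseteq> {f :: 'g \<Rightarrow> 'k. \<forall>g. g \<notin> H \<longrightarrow> f g = 0}"
    unfolding twisted_subalgebra_def
    by (rule fun_vs.span_minimal)
       (auto simp: tbasis_def fun_vs.subspace_def fun_scale_def)
next
  show "{f :: 'g \<Rightarrow> 'k. \<forall>g. g \<notin> H \<longrightarrow> f g = 0} \<subseteq> twisted_subalgebra H"
  proof
    fix f :: "'g \<Rightarrow> 'k" assume f: "f \<in> {f. \<forall>g. g \<notin> H \<longrightarrow> f g = 0}"
    have sum_app: "(\<Sum>x\<in>A. u x) g = (\<Sum>x\<in>A. u x g)" for A g and u :: "'g \<Rightarrow> 'g \<Rightarrow> 'k"
      by (induction A rule: infinite_finite_induct) auto
    have "f = (\<Sum>x\<in>H. fun_scale (f x) (tbasis x))"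
      using f assms
      by (auto simp: fun_eq_iff sum_app fun_scale_def tbasis_def if_distrib[of "(*) _"] cong: if_cong)
    also have "\<dots> \<in> twisted_subalgebra H"
      unfolding twisted_subalgebra_def
      by (intro fun_vs.span_sum fun_vs.span_scale fun_vs.span_base) auto
    finally show "f \<in> twisted_subalgebra H" .
  qed
qed

lemma carrier_twisted_group_algebra:
  "finite (carrier G) \<Longrightarrow> carrier (twisted_group_algebra G \<alpha>) = twisted_subalgebra (carrier G)"
  by (simp add: twisted_subalgebra_eq twisted_group_algebra_def)

lemma tmult_tbasis:
  assumes "finite (carrier G)" "x \<in> carrier G" "y \<in> carrier G"
  shows "tmult G \<alpha> (tbasis x) (tbasis y) = fun_scale (\<alpha> x y) (tbasis (x \<otimes>\<^bsub>G\<^esub> y))"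
proof
  fix z
  have "tmult G \<alpha> (tbasis x) (tbasis y) z =
      (\<Sum>u\<in>carrier G. if u = x then (\<Sum>v\<in>carrier G. if v = y then \<alpha> u v * tbasis (u \<otimes>\<^bsub>G\<^esub> v) z else 0) else 0)"
    unfolding tmult_def by (intro sum.cong refl) (auto simp: tbasis_def intro!: sum.cong)
  then show "tmult G \<alpha> (tbasis x) (tbasis y) z = fun_scale (\<alpha> x y) (tbasis (x \<otimes>\<^bsub>G\<^esub> y)) z"
    using assms by (simp add: fun_scale_def)
qed

lemma sum_tbasis:
  assumes "finite A" "a \<in> A"
  shows "(\<Sum>u\<in>A. tbasis a u * F u) = F a"
proof -
  have "(\<Sum>u\<in>A. tbasis a u * F u) = (\<Sum>u\<in>A. if u = a then F u else 0)"
    by (intro sum.cong) (auto simp: tbasis_def)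
  then show ?thesis using assms by simp
qed

lemma sum_rotate3:
  "(\<Sum>y\<in>A. \<Sum>w\<in>B. \<Sum>v\<in>D. P y w v) = (\<Sum>v\<in>D. \<Sum>y\<in>A. \<Sum>w\<in>B. P y w v)"
proof -
  have "(\<Sum>y\<in>A. \<Sum>w\<in>B. \<Sum>v\<in>D. P y w v) = (\<Sum>y\<in>A. \<Sum>v\<in>D. \<Sum>w\<in>B. P y w v)"
    by (rule sum.cong[OF refl], rule sum.swap)
  also have "\<dots> = (\<Sum>v\<in>D. \<Sum>y\<in>A. \<Sum>w\<in>B. P y w v)"
    by (rule sum.swap)
  finally show ?thesis .
qed

lemma sum_rotate4:
  "(\<Sum>u\<in>A. \<Sum>w\<in>B. \<Sum>x\<in>D. \<Sum>y\<in>E. P u w x y) =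
   (\<Sum>x\<in>D. \<Sum>y\<in>E. \<Sum>w\<in>B. \<Sum>u\<in>A. P u w x y)"
proof -
  have "(\<Sum>u\<in>A. \<Sum>w\<in>B. \<Sum>x\<in>D. \<Sum>y\<in>E. P u w x y) =
      (\<Sum>x\<in>D. \<Sum>u\<in>A. \<Sum>w\<in>B. \<Sum>y\<in>E. P u w x y)"
    by (rule sum_rotate3)
  also have "\<dots> = (\<Sum>x\<in>D. \<Sum>y\<in>E. \<Sum>u\<in>A. \<Sum>w\<in>B. P u w x y)"
    by (rule sum.cong[OF refl], rule sum_rotate3)
  also have "\<dots> = (\<Sum>x\<in>D. \<Sum>y\<in>E. \<Sum>w\<in>B. \<Sum>u\<in>A. P u w x y)"
    by (rule sum.cong[OF refl], rule sum.cong[OF refl], rule sum.swap)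
  finally show ?thesis .
qed

lemma tmult_assoc:
  assumes G: "group G" "finite (carrier G)" and \<alpha>: "two_cocycle G \<alpha>"
  shows "tmult G \<alpha> (tmult G \<alpha> f h) k = tmult G \<alpha> f (tmult G \<alpha> h k)"
proof
  fix z
  interpret group G by fact
  let ?S = "carrier G"
  have "tmult G \<alpha> (tmult G \<alpha> f h) k z =
      (\<Sum>u\<in>?S. \<Sum>w\<in>?S. \<Sum>x\<in>?S. \<Sum>y\<in>?S. tbasis (x \<otimes>\<^bsub>G\<^esub> y) u *
         (f x * h y * \<alpha> x y * k w * \<alpha> u w * tbasis (u \<otimes>\<^bsub>G\<^esub> w) z))"
    unfolding tmult_def by (simp add: sum_distrib_left sum_distrib_right mult_ac)
  also have "\<dots> = (\<Sum>x\<in>?S. \<Sum>y\<in>?S. \<Sum>w\<in>?S. \<Sum>u\<in>?S. tbasis (x \<otimes>\<^bsub>G\<^esub> y) u *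
         (f x * h y * \<alpha> x y * k w * \<alpha> u w * tbasis (u \<otimes>\<^bsub>G\<^esub> w) z))"
    by (rule sum_rotate4)
  also have "\<dots> = (\<Sum>x\<in>?S. \<Sum>y\<in>?S. \<Sum>w\<in>?S.
         f x * h y * k w * (\<alpha> x y * \<alpha> (x \<otimes>\<^bsub>G\<^esub> y) w) * tbasis ((x \<otimes>\<^bsub>G\<^esub> y) \<otimes>\<^bsub>G\<^esub> w) z)"
    using G by (intro sum.cong refl) (subst sum_tbasis, auto simp: mult_ac)
  also have "\<dots> = (\<Sum>x\<in>?S. \<Sum>y\<in>?S. \<Sum>w\<in>?S.
         f x * h y * k w * (\<alpha> y w * \<alpha> x (y \<otimes>\<^bsub>G\<^esub> w)) * tbasis (x \<otimes>\<^bsub>G\<^esub> (y \<otimes>\<^bsub>G\<^esub> w)) z)"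
    using \<alpha> by (intro sum.cong refl) (auto simp: two_cocycle_def m_assoc)
  also have "\<dots> = (\<Sum>x\<in>?S. \<Sum>y\<in>?S. \<Sum>w\<in>?S. \<Sum>v\<in>?S. tbasis (y \<otimes>\<^bsub>G\<^esub> w) v *
         (f x * h y * k w * \<alpha> y w * \<alpha> x v * tbasis (x \<otimes>\<^bsub>G\<^esub> v) z))"
    using G by (intro sum.cong refl) (subst sum_tbasis, auto simp: mult_ac)
  also have "\<dots> = (\<Sum>x\<in>?S. \<Sum>v\<in>?S. \<Sum>y\<in>?S. \<Sum>w\<in>?S. tbasis (y \<otimes>\<^bsub>G\<^esub> w) v *
         (f x * h y * k w * \<alpha> y w * \<alpha> x v * tbasis (x \<otimes>\<^bsub>G\<^esub> v) z))"
    by (rule sum.cong[OF refl], rule sum_rotate3)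
  also have "\<dots> = tmult G \<alpha> f (tmult G \<alpha> h k) z"
    unfolding tmult_def by (simp add: sum_distrib_left sum_distrib_right mult_ac)
  finally show "tmult G \<alpha> (tmult G \<alpha> f h) k z = tmult G \<alpha> f (tmult G \<alpha> h k) z" .
qed

lemma tmult_closed:
  assumes "group G" "g \<notin> carrier G"
  shows "tmult G \<alpha> f h g = 0"
proof -
  interpret group G by fact
  show ?thesis unfolding tmult_def using assms(2)
    by (intro sum.neutral ballI) (auto simp: tbasis_def)
qed

lemma tmult_one:
  assumes "group G" "finite (carrier G)" "two_cocycle G \<alpha>" "f \<in> carrier (twisted_group_algebra G \<alpha>)"
  shows "tmult G \<alpha> (tbasis \<one>\<^bsub>G\<^esub>) f = f" "tmult G \<alpha> f (tbasis \<one>\<^bsub>G\<^esub>) = f"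
proof -
  interpret group G by fact
  let ?S = "carrier G"
  have f: "g \<notin> ?S \<Longrightarrow> f g = 0" for g using assms(4) by (auto simp: twisted_group_algebra_def)
  have f': "(\<Sum>y\<in>?S. f y * tbasis y z) = f z" for z
  proof -
    have "(\<Sum>y\<in>?S. f y * tbasis y z) = (\<Sum>y\<in>?S. if y = z then f y else 0)"
      by (intro sum.cong) (auto simp: tbasis_def)
    then show ?thesis using assms(2) f by simp
  qed
  have "tmult G \<alpha> (tbasis \<one>\<^bsub>G\<^esub>) f z = f z" for z
  proof -
  have "tmult G \<alpha> (tbasis \<one>\<^bsub>G\<^esub>) f z = (\<Sum>x\<in>?S. tbasis \<one>\<^bsub>G\<^esub> x * (\<Sum>y\<in>?S. f y * \<alpha> x y * tbasis (x \<otimes>\<^bsub>G\<^esub> y) z))"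
    unfolding tmult_def by (simp add: sum_distrib_left mult_ac)
  also have "\<dots> = f z"
    using assms(2,3) by (subst sum_tbasis) (auto simp: two_cocycle_def f')
  finally show ?thesis .
  qed
  then show "tmult G \<alpha> (tbasis \<one>\<^bsub>G\<^esub>) f = f" by blast
  have "tmult G \<alpha> f (tbasis \<one>\<^bsub>G\<^esub>) z = f z" for z
  proof -
  have "tmult G \<alpha> f (tbasis \<one>\<^bsub>G\<^esub>) z = (\<Sum>x\<in>?S. \<Sum>y\<in>?S. tbasis \<one>\<^bsub>G\<^esub> y * (f x * \<alpha> x y * tbasis (x \<otimes>\<^bsub>G\<^esub> y) z))"
    unfolding tmult_def by (simp add: mult_ac)
  also have "\<dots> = f z"
    using assms(2,3) by (subst sum_tbasis) (auto simp: two_cocycle_def f')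
  finally show ?thesis .
  qed
  then show "tmult G \<alpha> f (tbasis \<one>\<^bsub>G\<^esub>) = f" by blast
qed

lemma ring_twisted_group_algebra:
  assumes "group G" "finite (carrier G)" "two_cocycle G \<alpha>"
  shows "ring (twisted_group_algebra G \<alpha>)"
proof -
  interpret group G by fact
  show ?thesis
  proof (rule ringI)
    show "abelian_group (twisted_group_algebra G \<alpha>)"
    proof (rule abelian_groupI)
      fix f assume "f \<in> carrier (twisted_group_algebra G \<alpha>)"
      then show "\<exists>h\<in>carrier (twisted_group_algebra G \<alpha>).
          h \<oplus>\<^bsub>twisted_group_algebra G \<alpha>\<^esub> f = \<zero>\<^bsub>twisted_group_algebra G \<alpha>\<^esub>"
        by (intro bexI[of _ "- f"]) (auto simp: twisted_group_algebra_def)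
    qed (auto simp: twisted_group_algebra_def add_ac)
    show "Group.monoid (twisted_group_algebra G \<alpha>)"
      by (rule Group.monoidI)
         (use assms tmult_one[OF assms] tmult_assoc[OF assms] tmult_closed[OF assms(1)] in
           \<open>auto simp: twisted_group_algebra_def tbasis_def\<close>)
  qed (auto simp: twisted_group_algebra_def tmult_def fun_eq_iff sum.distrib ring_distribs)
qed

end

(* Let c be a codeword of minimum weight d with support S. The translates c * g have supports S g,
   which cover G, so the supports of any basis of c K^\<alpha>G chosen among the translates cover G as
   well, and |G| \<le> d dim C. In case of equality such a basis has disjoint supports and spans C;
   since any two translates one of whose supports is not contained in the other extend to such a
   basis, the sets S g are pairwise equal or disjoint. Normalising 1 \<in> S makes S a subgroup H.
   Conversely, if c K^\<alpha>H is the line through c, then the translates of c by coset representatives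
   of H form a basis of c K^\<alpha>G, because their supports are disjoint. *)

theory Submission
  imports Defs
begin

section \<open>Linear algebra of coefficient functions\<close>

interpretation fun_vsp: vector_space_pair
  "fun_scale :: 'k::field \<Rightarrow> ('g \<Rightarrow> 'k) \<Rightarrow> 'g \<Rightarrow> 'k"
  "fun_scale :: 'k::field \<Rightarrow> ('g \<Rightarrow> 'k) \<Rightarrow> 'g \<Rightarrow> 'k" ..

text \<open>Evaluation at \<open>x\<close> is linear, so its kernel is a subspace. This is the link
  between supports and spans used for both covering and independence.\<close>

lemma span_eval_zero:
  assumes "f \<in> fun_vs.span A" "\<And>a. a \<in> A \<Longrightarrow> a x = 0"
  shows "f x = 0"
proof -
  have "fun_vs.span A \<subseteq> {f. f x = 0}"
    using assms(2) by (intro fun_vs.span_minimal) (auto simp: fun_vs.subspace_def fun_scale_def)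
  then show ?thesis using assms(1) by auto
qed

text \<open>A coordinate at which \<open>a\<close> alone is nonzero keeps \<open>a\<close> out of
  the span of the other elements. Vectors with disjoint nonempty supports are the intended
  case.\<close>

lemma independent_if_private_coordinate:
  assumes "\<And>a. a \<in> A \<Longrightarrow> \<exists>x. a x \<noteq> 0 \<and> (\<forall>b\<in>A - {a}. b x = 0)"
  shows "fun_vs.independent A"
proof
  assume "fun_vs.dependent A"
  then obtain a where a: "a \<in> A" "a \<in> fun_vs.span (A - {a})"
    by (auto simp: fun_vs.dependent_def)
  obtain x where "a x \<noteq> 0" "\<forall>b\<in>A - {a}. b x = 0" using assms[OF a(1)] by blast
  then show False using span_eval_zero[OF a(2)] by blast
qed

context vector_space
begin

text \<open>Extending \<open>B\<close> to a basis of \<open>V\<close> adds nothing, by counting. The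
  finite set \<open>T\<close> makes that basis finite, so that its \<open>card\<close> is
  meaningful.\<close>

lemma span_eq_of_dim_le_card:
  assumes "subspace V" "B \<subseteq> V" "independent B" "dim V \<le> card B" "V \<subseteq> span T" "finite T"
  shows "span B = V"
proof -
  obtain B' where B': "B \<subseteq> B'" "B' \<subseteq> V" "independent B'" "V \<subseteq> span B'"
    using maximal_independent_subset_extend[OF assms(2,3)] by blast
  have "finite B'"
    using independent_span_bound[OF assms(6) B'(3)] B'(2) assms(5) by blast
  moreover have "card B' = dim V"
    using dim_unique[OF B'(2,4,3)] by simp
  ultimately have "B = B'"
    using B'(1) assms(4) by (intro card_seteq) auto
  then show ?thesis
    using B' assms(1) span_minimal by blast
qed

lemma card_le_dim_if_independent:
  assumes "B \<subseteq> V" "independent B" "V \<subseteq> span T" "finite T"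
  shows "finite B \<and> card B \<le> dim V"
proof -
  obtain B' where B': "B \<subseteq> B'" "B' \<subseteq> V" "independent B'" "V \<subseteq> span B'"
    using maximal_independent_subset_extend[OF assms(1,2)] by blast
  have "finite B'"
    using independent_span_bound[OF assms(4) B'(3)] B'(2) assms(3) by blast
  moreover have "card B' = dim V"
    using dim_unique[OF B'(2,4,3)] by simp
  ultimately show ?thesis
    using B'(1) by (metis card_mono finite_subset)
qed

end

section \<open>Translates of an algebra element and their supports\<close>

locale twisted_group = group G for G :: "('g, 'm) monoid_scheme" (structure) +
  fixes \<alpha> :: "'g \<Rightarrow> 'g \<Rightarrow> 'k::field"
  assumes finite_carrier: "finite (carrier G)"
    and cocycle: "two_cocycle G \<alpha>"
begin

abbreviation A where "A \<equiv> twisted_group_algebra G \<alpha>"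

abbreviation translate :: "('g \<Rightarrow> 'k) \<Rightarrow> 'g \<Rightarrow> 'g \<Rightarrow> 'k" where
  "translate c g \<equiv> tmult G \<alpha> c (tbasis g)"

lemma carrier_A: "f \<in> carrier A \<longleftrightarrow> (\<forall>g. g \<notin> carrier G \<longrightarrow> f g = 0)"
  by (simp add: twisted_group_algebra_def)

lemma mult_A: "f \<otimes>\<^bsub>A\<^esub> h = tmult G \<alpha> f h"
  by (simp add: twisted_group_algebra_def)

lemma alpha_nonzero: "x \<in> carrier G \<Longrightarrow> y \<in> carrier G \<Longrightarrow> \<alpha> x y \<noteq> 0"
  using cocycle by (simp add: two_cocycle_def)

lemma linear_tmult: "Vector_Spaces.linear fun_scale fun_scale (tmult G \<alpha> c)"
  unfolding Vector_Spaces.linear_iff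
  by (auto simp: fun_vs.vector_space_axioms tmult_def fun_scale_def fun_eq_iff algebra_simps sum.distrib sum_distrib_left)

lemma tmult_scale_left: "tmult G \<alpha> (fun_scale k c) f = fun_scale k (tmult G \<alpha> c f)"
  by (auto simp: tmult_def fun_scale_def fun_eq_iff algebra_simps sum_distrib_left)

text \<open>Left multiplication by \<open>c\<close> is linear, so it maps the span of basis elements
  onto the span of their images. Questions about ideals thereby become questions about
  translates.\<close>

lemma l_coset_subalgebra:
  "c <#\<^bsub>A\<^esub> twisted_subalgebra H = fun_vs.span (translate c ` H)"
proof -
  have "c <#\<^bsub>A\<^esub> twisted_subalgebra H = tmult G \<alpha> c ` fun_vs.span (tbasis ` H)"
    by (auto simp: l_coset_def mult_A twisted_subalgebra_def)
  also have "\<dots> = fun_vs.span (tmult G \<alpha> c ` tbasis ` H)"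
    by (rule fun_vsp.linear_span_image[OF linear_tmult, symmetric])
  finally show ?thesis by (simp add: image_image)
qed

lemma l_coset_algebra:
  "c <#\<^bsub>A\<^esub> carrier A = fun_vs.span (translate c ` carrier G)"
  by (simp add: carrier_twisted_group_algebra finite_carrier l_coset_subalgebra)

text \<open>Right multiplication by a basis element moves coordinates by a group translation and
  rescales each by a cocycle value.\<close>

lemma translate_apply:
  assumes "x \<in> carrier G" "g \<in> carrier G"
  shows "translate c g (x \<otimes> g) = c x * \<alpha> x g"
proof -
  have "translate c g (x \<otimes> g) =
      (\<Sum>u\<in>carrier G. \<Sum>v\<in>carrier G. tbasis g v * (c u * \<alpha> u v * tbasis (u \<otimes> v) (x \<otimes> g)))"
    by (simp add: tmult_def mult_ac)
  also have "\<dots> = (\<Sum>u\<in>carrier G. c u * \<alpha> u g * tbasis (u \<otimes> g) (x \<otimes> g))"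
    using assms finite_carrier by (simp add: sum_tbasis)
  \<comment> \<open>Right cancellation of \<open>g\<close> brings the sum into the shape that
    \<open>sum_tbasis\<close> collapses.\<close>
  also have "\<dots> = (\<Sum>u\<in>carrier G. tbasis x u * (c u * \<alpha> u g))"
    using assms by (intro sum.cong) (auto simp: tbasis_def)
  finally show ?thesis
    using assms finite_carrier by (simp add: sum_tbasis)
qed

text \<open>Cocycle values are nonzero, so the twist changes coefficients but not supports, which
  move as in the ordinary group algebra.\<close>

lemma supp_translate:
  assumes "g \<in> carrier G"
  shows "supp G (translate c g) = supp G c #> g"
proof (intro equalityI subsetI)
  fix x assume x: "x \<in> supp G (translate c g)"
  then have xG: "x \<in> carrier G" by (simp add: supp_def)
  define y where "y = x \<otimes> inv g"
  have y: "y \<in> carrier G" "x = y \<otimes> g"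
    using xG assms by (auto simp: y_def m_assoc)
  then show "x \<in> supp G c #> g"
    using x assms by (auto simp: supp_def r_coset_def translate_apply)
next
  fix x assume "x \<in> supp G c #> g"
  then show "x \<in> supp G (translate c g)"
    using assms alpha_nonzero by (auto simp: supp_def r_coset_def translate_apply)
qed

lemma card_supp_translate:
  assumes "g \<in> carrier G"
  shows "card (supp G (translate c g)) = card (supp G c)"
proof -
  have "supp G c #> g = (\<lambda>x. x \<otimes> g) ` supp G c"
    by (auto simp: r_coset_def)
  moreover have "inj_on (\<lambda>x. x \<otimes> g) (supp G c)"
    using assms by (auto simp: inj_on_def supp_def)
  ultimately show ?thesis
    by (simp add: supp_translate[OF assms] card_image)
qed

lemma supp_eq_empty_iff: "f \<in> carrier A \<Longrightarrow> supp G f = {} \<longleftrightarrow> f = 0"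
  by (auto simp: carrier_A supp_def fun_eq_iff)

lemma finite_supp: "finite (supp G f)"
  using finite_carrier by (simp add: supp_def)

lemma translate_one: "c \<in> carrier A \<Longrightarrow> translate c \<one> = c"
  using tmult_one[OF is_group finite_carrier cocycle] by simp

text \<open>Translation is a right action only up to nonzero scalars: associativity of the twisted
  product leaves the factor \<open>\<alpha> g h\<close>. Spans do not see this factor.\<close>

lemma translate_mult:
  assumes "g \<in> carrier G" "h \<in> carrier G"
  shows "translate c (g \<otimes> h) = fun_scale (inverse (\<alpha> g h)) (translate (translate c g) h)"
proof -
  have "translate (translate c g) h = tmult G \<alpha> c (fun_scale (\<alpha> g h) (tbasis (g \<otimes> h)))"
    using assms
    by (simp add: tmult_assoc[OF is_group finite_carrier cocycle] tmult_tbasis finite_carrier)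
  also have "\<dots> = fun_scale (\<alpha> g h) (translate c (g \<otimes> h))"
    using fun_vsp.linear_scale[OF linear_tmult] by blast
  finally show ?thesis
    using alpha_nonzero[OF assms] by simp
qed

lemma subalgebra_subset: "H \<subseteq> carrier G \<Longrightarrow> twisted_subalgebra H \<subseteq> carrier A"
  using twisted_subalgebra_eq[OF finite_subset[OF _ finite_carrier], of H]
  by (fastforce simp: carrier_A)

lemma carrier_A_subset_span: "carrier A \<subseteq> fun_vs.span (tbasis ` carrier G)"
  by (simp add: carrier_twisted_group_algebra finite_carrier twisted_subalgebra_def)

section \<open>Minimum weight, and right ideals as subspaces\<close>

lemma finite_weights: "finite {card (supp G f) |f. f \<in> C \<and> f \<noteq> 0}"
proof (rule finite_subset)
  show "{card (supp G f) |f. f \<in> C \<and> f \<noteq> 0} \<subseteq> {..card (carrier G)}"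
    using finite_carrier by (auto simp: supp_def intro!: card_mono)
qed simp

lemma min_dist_le: "f \<in> C \<Longrightarrow> f \<noteq> 0 \<Longrightarrow> min_dist G C \<le> card (supp G f)"
  unfolding min_dist_def by (intro Min_le finite_weights) auto

lemma min_dist_attained:
  assumes "f \<in> C" "f \<noteq> 0"
  obtains c where "c \<in> C" "c \<noteq> 0" "card (supp G c) = min_dist G C"
proof -
  have "min_dist G C \<in> {card (supp G f) |f. f \<in> C \<and> f \<noteq> 0}"
    unfolding min_dist_def using assms by (intro Min_in finite_weights) auto
  then show ?thesis using that by auto
qed

text \<open>\<open>right_ideal\<close> speaks only of the ring structure. Closure under scalars
  comes from right multiplication by scalar multiples of the identity.\<close>

lemma subspace_right_ideal:
  assumes "right_ideal C A"
  shows "fun_vs.subspace C"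
proof -
  interpret R: ring A
    by (rule ring_twisted_group_algebra[OF is_group finite_carrier cocycle])
  interpret additive_subgroup C A
    using assms by (simp add: right_ideal_def)
  have "fun_scale k f \<in> C" if "f \<in> C" for k f
  proof -
    have "fun_scale k (tbasis \<one>) \<in> carrier A"
      by (auto simp: carrier_A fun_scale_def tbasis_def)
    then have "tmult G \<alpha> f (fun_scale k (tbasis \<one>)) \<in> C"
      using assms that by (auto simp: right_ideal_def mult_A)
    moreover have "tmult G \<alpha> f (fun_scale k (tbasis \<one>)) = fun_scale k (translate f \<one>)"
      using fun_vsp.linear_scale[OF linear_tmult] by blast
    moreover have "f \<in> carrier A" using that a_subset by blast
    ultimately show ?thesis by (simp add: translate_one)
  qed
  then show ?thesis
    using zero_closed a_closed
    by (auto simp: fun_vs.subspace_def twisted_group_algebra_def)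
qed

lemma translate_right_ideal:
  assumes "right_ideal C A" "c \<in> C" "g \<in> carrier G"
  shows "translate c g \<in> C"
proof -
  have "tbasis g \<in> carrier A"
    using assms(3) by (auto simp: carrier_A tbasis_def)
  then show ?thesis
    using assms by (auto simp: right_ideal_def mult_A)
qed

section \<open>The covering bound and its equality case\<close>

text \<open>The translate by \<open>x\<close> is nonzero at \<open>x\<close> because
  \<open>c\<close> is nonzero at the identity. If all of \<open>B\<close> vanished at
  \<open>x\<close>, so would its span.\<close>

lemma supports_cover:
  assumes "\<one> \<in> supp G c" "translate c ` carrier G \<subseteq> fun_vs.span B"
  shows "carrier G \<subseteq> (\<Union>b\<in>B. supp G b)"
proof
  fix x assume x: "x \<in> carrier G"
  then have "x \<in> supp G c #> x"
    using assms(1) by (auto simp: r_coset_def intro!: bexI[of _ \<one>])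
  then have "translate c x x \<noteq> 0"
    using supp_translate[OF x] by (auto simp: supp_def)
  moreover have "translate c x \<in> fun_vs.span B" using assms(2) x by blast
  ultimately obtain b where "b \<in> B" "b x \<noteq> 0"
    using span_eval_zero by metis
  then show "x \<in> (\<Union>b\<in>B. supp G b)"
    using x by (auto simp: supp_def)
qed

text \<open>Equality leaves no slack in the count of points covered by a basis of translates. The
  witnesses are a minimum weight word normalised at the identity and its support.\<close>

lemma line_if_extremal:
  assumes "right_ideal C A" "C \<noteq> {0}" "min_dist G C * fun_vs.dim C = order G"
  obtains H c where "subgroup H G" "c \<in> twisted_subalgebra H" "card H = min_dist G C"
    "fun_vs.dim (c <#\<^bsub>A\<^esub> twisted_subalgebra H) = 1" "C = c <#\<^bsub>A\<^esub> carrier A"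
proof -
  let ?d = "min_dist G C"
  have sub: "fun_vs.subspace C" by (rule subspace_right_ideal[OF assms(1)])
  have CA: "C \<subseteq> carrier A"
    using assms(1) by (simp add: right_ideal_def additive_subgroup.a_subset)
  have Cspan: "C \<subseteq> fun_vs.span (tbasis ` carrier G)"
    using CA carrier_A_subset_span by blast
  have fin: "finite (tbasis ` carrier G :: ('g \<Rightarrow> 'k) set)"
    using finite_carrier by simp
  obtain f where "f \<in> C" "f \<noteq> 0"
    using assms(2) fun_vs.subspace_0[OF sub] by auto
  then obtain c0 where c0: "c0 \<in> C" "c0 \<noteq> 0" "card (supp G c0) = ?d"
    by (rule min_dist_attained)
  then obtain s where s: "s \<in> supp G c0"
    using supp_eq_empty_iff CA by blast
  then have sG: "s \<in> carrier G" by (simp add: supp_def)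
  \<comment> \<open>Shifting by \<open>inv s\<close> moves the support point \<open>s\<close> to the
    identity and preserves the weight.\<close>
  define c where "c = translate c0 (inv s)"
  define H where "H = supp G c"
  have cC: "c \<in> C"
    unfolding c_def using translate_right_ideal[OF assms(1) c0(1)] sG by simp
  then have cA: "c \<in> carrier A" using CA by blast
  have "H = supp G c0 #> inv s"
    using sG by (simp add: H_def c_def supp_translate)
  then have one: "\<one> \<in> H"
    using s sG by (auto simp: r_coset_def intro!: bexI[of _ s])
  have card_H: "card H = ?d"
    using c0(3) sG by (simp add: H_def c_def card_supp_translate)
  have HG: "H \<subseteq> carrier G" by (auto simp: H_def supp_def)
  have finH: "finite H" using HG finite_carrier finite_subset by blast
  have d_pos: "?d > 0"
    using one finH card_H by (metis card_gt_0_iff empty_iff)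
  have translates: "translate c ` carrier G \<subseteq> C"
    using translate_right_ideal[OF assms(1) cC] by blast
  have c1: "c = translate c \<one>" using translate_one[OF cA] by simp

  \<comment> \<open>\<open>B\<close> is a basis of the span of the translates. That this span is all
    of \<open>C\<close> is not yet known, so only an upper bound on \<open>card B\<close> is
    claimed.\<close>
  have extend: "\<exists>B. B0 \<subseteq> B \<and> B \<subseteq> translate c ` carrier G \<and> fun_vs.independent B \<and> finite B \<and>
      card B \<le> fun_vs.dim C \<and> carrier G \<subseteq> (\<Union>b\<in>B. supp G b)"
    if B0: "B0 \<subseteq> translate c ` carrier G" "fun_vs.independent B0" for B0
  proof -
    obtain B where B: "B0 \<subseteq> B" "B \<subseteq> translate c ` carrier G" "fun_vs.independent B"
      "translate c ` carrier G \<subseteq> fun_vs.span B"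
      using fun_vs.maximal_independent_subset_extend[OF B0] by blast
    have "finite B \<and> card B \<le> fun_vs.dim C"
      using fun_vs.card_le_dim_if_independent[OF _ B(3) Cspan fin] B(2) translates by blast
    then show ?thesis
      using B supports_cover[OF _ B(4)] one by (auto simp: H_def intro!: exI[of _ B])
  qed
  have weight: "card (supp G b) = ?d" if "b \<in> translate c ` carrier G" for b
    using that card_H by (auto simp: card_supp_translate H_def)

  \<comment> \<open>Otherwise \<open>c\<close> and its translate are independent and lie in a common
    basis of translates. Their supports overlap, so that basis covers too few points.\<close>
  have shift_subset: "H #> g \<subseteq> H" if g: "g \<in> carrier G" and meet: "(H #> g) \<inter> H \<noteq> {}" for g
  proof (rule ccontr)
    assume "\<not> H #> g \<subseteq> H"
    have supp_g: "supp G (translate c g) = H #> g"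
      using g by (simp add: supp_translate H_def)
    \<comment> \<open>A point of \<open>H #> g\<close> outside \<open>H\<close> shows that the
      translate is no multiple of \<open>c\<close>.\<close>
    then obtain x where "x \<in> carrier G" "translate c g x \<noteq> 0" "c x = 0"
      using \<open>\<not> H #> g \<subseteq> H\<close> by (auto simp: H_def supp_def)
    then have "translate c g \<notin> fun_vs.span {c}"
      using span_eval_zero[of "translate c g" "{c}" x] by auto
    moreover have "c \<noteq> 0" using one by (auto simp: H_def supp_def)
    ultimately have ind: "fun_vs.independent {translate c g, c}" and ne: "translate c g \<noteq> c"
      using fun_vs.span_base[of c "{c}"] by (auto simp: fun_vs.independent_insert)
    obtain B where B: "{translate c g, c} \<subseteq> B" "B \<subseteq> translate c ` carrier G" "finite B"
      "card B \<le> fun_vs.dim C" "carrier G \<subseteq> (\<Union>b\<in>B. supp G b)"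
      using extend[OF _ ind] g c1 by (metis empty_subsetI image_eqI insert_subset one_closed)
    \<comment> \<open>The two overlapping supports are counted apart from the rest, since their
      union has strictly fewer than \<open>2 * ?d\<close> points.\<close>
    define B' where "B' = B - {translate c g, c}"
    have card_B: "card B = card B' + 2"
    proof -
      have "card {translate c g, c} = 2" using ne by simp
      moreover have "card {translate c g, c} \<le> card B" using B by (intro card_mono) auto
      ultimately show ?thesis
        using B(1,3) by (simp add: B'_def card_Diff_subset)
    qed
    have "order G \<le> card ((H #> g) \<union> H \<union> (\<Union>b\<in>B'. supp G b))"
      unfolding order_def
    proof (rule card_mono)
      show "finite ((H #> g) \<union> H \<union> (\<Union>b\<in>B'. supp G b))"
        using finH B(3) by (simp add: B'_def finite_supp flip: supp_g)
      have "(\<Union>b\<in>B. supp G b) \<subseteq> supp G (translate c g) \<union> supp G c \<union> (\<Union>b\<in>B'. supp G b)"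
        unfolding B'_def by blast
      then show "carrier G \<subseteq> (H #> g) \<union> H \<union> (\<Union>b\<in>B'. supp G b)"
        using B(5) unfolding supp_g H_def[symmetric] by (rule order_trans[rotated])
    qed
    also have "\<dots> \<le> card ((H #> g) \<union> H) + card (\<Union>b\<in>B'. supp G b)"
      by (rule card_Un_le)
    also have "card (\<Union>b\<in>B'. supp G b) \<le> (\<Sum>b\<in>B'. card (supp G b))"
      using B(3) by (intro card_UN_le) (simp add: B'_def)
    also have "(\<Sum>b\<in>B'. card (supp G b)) = card B' * ?d"
      using weight B(2) by (simp add: B'_def subset_iff)
    finally have "order G \<le> card ((H #> g) \<union> H) + card B' * ?d" by simp
    moreover have "card ((H #> g) \<union> H) < 2 * ?d"
    proof -
      have "finite (H #> g)" using finite_supp[of "translate c g"] supp_g by simp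
      then have "card ((H #> g) \<union> H) + card ((H #> g) \<inter> H) = card (H #> g) + card H"
        using finH card_Un_Int by metis
      moreover have "card (H #> g) = ?d"
        using weight[of "translate c g"] g supp_g by auto
      moreover have "card ((H #> g) \<inter> H) > 0"
        using meet finH by (simp add: card_gt_0_iff)
      ultimately show ?thesis using card_H by simp
    qed
    ultimately have "order G < card B * ?d"
      by (simp add: card_B add_mult_distrib)
    also have "\<dots> \<le> fun_vs.dim C * ?d" using B(4) by simp
    finally show False using assms(3) by (simp add: mult.commute)
  qed
  \<comment> \<open>The identity, written as \<open>t \<otimes> inv t\<close>, is a common point of
    \<open>H\<close> and its shift.\<close>
  have inv_shift: "H #> inv t \<subseteq> H" if "t \<in> H" for t
  proof (rule shift_subset)
    have "t \<otimes> inv t \<in> H #> inv t" using that by (auto simp: r_coset_def)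
    then show "(H #> inv t) \<inter> H \<noteq> {}" using one that HG by (auto simp: subset_iff)
  qed (use that HG in auto)
  have inv_H: "inv t \<in> H" if "t \<in> H" for t
  proof -
    have "\<one> \<otimes> inv t \<in> H #> inv t" using one by (auto simp: r_coset_def)
    moreover have "inv t \<in> carrier G" using that HG by auto
    ultimately show ?thesis using inv_shift[OF that] by auto
  qed
  have H: "subgroup H G"
  proof (rule subgroupI)
    fix a b assume ab: "a \<in> H" "b \<in> H"
    \<comment> \<open>Only shifts by inverses are controlled, so \<open>b\<close> is written as the
      inverse of \<open>inv b\<close>, which already lies in \<open>H\<close>.\<close>
    have "a \<otimes> inv (inv b) \<in> H #> inv (inv b)"
      using ab by (auto simp: r_coset_def)
    then show "a \<otimes> b \<in> H"
      using inv_shift[OF inv_H[OF ab(2)]] subsetD[OF HG ab(2)] by auto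
  qed (use HG one inv_H in auto)

  have c_sub: "c \<in> twisted_subalgebra H"
    using cA finH by (auto simp: twisted_subalgebra_eq H_def supp_def carrier_A)

  have line: "translate c h \<in> fun_vs.span {c}" if h: "h \<in> H" for h
  proof -
    have hG: "h \<in> carrier G" using h HG by blast
    have c_one: "c \<one> \<noteq> 0" using one by (simp add: H_def supp_def)
    \<comment> \<open>This scalar cancels the coefficient at the identity. The difference
      \<open>v\<close> is a codeword supported in \<open>H - {\<one>}\<close>, too light to be
      nonzero.\<close>
    define k where "k = translate c h \<one> / c \<one>"
    define v where "v = translate c h - fun_scale k c"
    have "v \<in> C"
      unfolding v_def using sub cC hG translates
      by (intro fun_vs.subspace_diff fun_vs.subspace_scale) auto
    have "supp G (translate c h) = H"
      using supp_translate[OF hG] coset_join2[OF hG H h] unfolding H_def by (rule trans)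
    moreover have "supp G v \<subseteq> supp G (translate c h) \<union> supp G c"
      by (auto simp: v_def supp_def fun_scale_def)
    ultimately have "supp G v \<subseteq> H" unfolding H_def by blast
    moreover have "v \<one> = 0" using c_one by (simp add: v_def k_def fun_scale_def)
    ultimately have "supp G v \<subseteq> H - {\<one>}" by (auto simp: supp_def)
    then have "card (supp G v) < card H"
      using finH one by (intro psubset_card_mono) auto
    then have "v = 0"
      using min_dist_le[OF \<open>v \<in> C\<close>] card_H by fastforce
    then have "translate c h = fun_scale k c" by (simp add: v_def)
    then show ?thesis by (simp add: fun_vs.span_base fun_vs.span_scale)
  qed
  have "c \<noteq> 0" using one by (auto simp: H_def supp_def)
  moreover have "c \<in> translate c ` H"
    using c1 one by (rule image_eqI)
  moreover have "fun_vs.span (translate c ` H) \<subseteq> fun_vs.span {c}"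
    using line by (intro fun_vs.span_minimal fun_vs.subspace_span) blast
  ultimately have dim: "fun_vs.dim (c <#\<^bsub>A\<^esub> twisted_subalgebra H) = 1"
    unfolding l_coset_subalgebra
    by (intro fun_vs.dim_unique[of "{c}"]) (auto intro: fun_vs.span_base)

  \<comment> \<open>Covering now bounds \<open>card B\<close> from below: cancelling the positive
    \<open>?d\<close> gives at least \<open>fun_vs.dim C\<close> elements, so the translates span
    \<open>C\<close>.\<close>
  obtain B where B: "B \<subseteq> translate c ` carrier G" "fun_vs.independent B" "finite B"
    "carrier G \<subseteq> (\<Union>b\<in>B. supp G b)"
    using extend[of "{}"] fun_vs.independent_empty by blast
  have "order G \<le> card (\<Union>b\<in>B. supp G b)"
    unfolding order_def using B finite_supp by (intro card_mono) auto
  also have "\<dots> \<le> (\<Sum>b\<in>B. card (supp G b))"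
    using B by (intro card_UN_le)
  also have "\<dots> = card B * ?d"
    using weight B(1) by (simp add: subset_iff)
  finally have "fun_vs.dim C \<le> card B"
    using d_pos by (simp flip: assms(3) add: mult.commute)
  then have "fun_vs.span B = C"
    using fun_vs.span_eq_of_dim_le_card[OF sub _ B(2) _ Cspan fin] B(1) translates by blast
  then have "C = c <#\<^bsub>A\<^esub> carrier A"
    unfolding l_coset_algebra
    using fun_vs.span_mono[OF B(1)] fun_vs.span_minimal[OF translates sub] by blast
  then show ?thesis
    using that[OF H c_sub card_H dim] by blast
qed

section \<open>Codes generated from a line in a subgroup algebra\<close>

text \<open>Translating by \<open>H\<close> only rescales \<open>c\<close>, so one translate per
  right coset suffices for spanning. Each is supported in its own coset, and Lagrange's theorem
  gives the count.\<close>

lemma dim_if_line: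
  assumes H: "subgroup H G" and c: "c \<in> twisted_subalgebra H" "c \<noteq> 0"
    and dim: "fun_vs.dim (c <#\<^bsub>A\<^esub> twisted_subalgebra H) = 1"
  shows "card H * fun_vs.dim (c <#\<^bsub>A\<^esub> carrier A) = order G"
proof -
  have HG: "H \<subseteq> carrier G" using H by (rule subgroup.subset)
  then have finH: "finite H" using finite_carrier finite_subset by blast
  have cA: "c \<in> carrier A" using subalgebra_subset[OF HG] c by blast
  have supp_c: "supp G c \<subseteq> H" "supp G c \<noteq> {}"
    using c supp_eq_empty_iff[OF cA] finH by (auto simp: twisted_subalgebra_eq supp_def)
  let ?V = "fun_vs.span (translate c ` H)"
  have "c \<in> translate c ` H"
    using translate_one[OF cA] subgroup.one_closed[OF H] by force
  \<comment> \<open>The nonzero vector \<open>c\<close> lies in the one-dimensional space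
    \<open>?V\<close> and hence spans it.\<close>
  then have "fun_vs.span {c} = ?V"
    using c(2) dim finH unfolding l_coset_subalgebra
    by (intro fun_vs.span_eq_of_dim_le_card[where T = "translate c ` H"])
      (auto intro: fun_vs.span_base)
  then have line: "\<exists>k. translate c h = fun_scale k c" if "h \<in> H" for h
    using that fun_vs.span_base[of "translate c h" "translate c ` H"]
    by (auto simp: fun_vs.span_singleton)

  define r where "r R = (SOME t. t \<in> R)" for R :: "'g set"
  have r: "r R \<in> carrier G \<and> H #> r R = R" if R: "R \<in> rcosets H" for R
  proof -
    obtain a where a: "a \<in> carrier G" "R = H #> a"
      using R by (auto simp: RCOSETS_def)
    then have "a \<in> R" using rcos_self[OF a(1) H] by simp
    then have "r R \<in> R" unfolding r_def by (rule someI)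
    moreover have "R \<subseteq> carrier G" using a HG r_coset_subset_G by blast
    ultimately show ?thesis
      using a repr_independence[OF _ a(1) H] by auto
  qed
  define b where "b R = translate c (r R)" for R
  have supp_b: "supp G (b R) \<subseteq> R \<and> supp G (b R) \<noteq> {}" if "R \<in> rcosets H" for R
  proof -
    have "supp G (b R) = supp G c #> r R" using r[OF that] by (simp add: b_def supp_translate)
    moreover have "H #> r R = R" using r[OF that] by simp
    ultimately show ?thesis
      using supp_c by (auto simp: r_coset_def)
  qed
  have disj: "R \<inter> S = {}" if "R \<in> rcosets H" "S \<in> rcosets H" "R \<noteq> S" for R S
    using rcos_disjoint[OF H] that by (auto simp: pairwise_def disjnt_def)
  \<comment> \<open>Injectivity makes the image have as many elements as there are cosets: equal
    translates would share a nonempty support inside two disjoint cosets.\<close>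
  have inj: "inj_on b (rcosets H)"
  proof (intro inj_onI, rule ccontr)
    fix R S assume RS: "R \<in> rcosets H" "S \<in> rcosets H" "b R = b S" "R \<noteq> S"
    then have "supp G (b R) \<subseteq> R \<inter> S"
      using supp_b[OF RS(1)] supp_b[OF RS(2)] by simp
    then show False
      using disj[OF RS(1,2,4)] supp_b[OF RS(1)] by simp
  qed
  have "fun_vs.independent (b ` (rcosets H))"
  proof (rule independent_if_private_coordinate)
    fix a assume "a \<in> b ` (rcosets H)"
    then obtain R where R: "R \<in> rcosets H" "a = b R" by blast
    then obtain x where x: "x \<in> supp G (b R)" using supp_b by blast
    have "b S x = 0" if "S \<in> rcosets H" "b S \<noteq> b R" for S
    proof (rule ccontr)
      assume "b S x \<noteq> 0"
      then have "x \<in> supp G (b S)" using x by (simp add: supp_def)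
      then have "x \<in> R \<inter> S" using x supp_b R(1) that(1) by blast
      then show False using disj R(1) that by blast
    qed
    then show "\<exists>x. a x \<noteq> 0 \<and> (\<forall>b\<in>b ` (rcosets H) - {a}. b x = 0)"
      using x R by (auto simp: supp_def intro!: exI[of _ x])
  qed
  moreover have "translate c g \<in> fun_vs.span (b ` (rcosets H))" if g: "g \<in> carrier G" for g
  proof -
    define R where "R = H #> g"
    have R: "R \<in> rcosets H" using g HG by (simp add: R_def rcosetsI)
    have "g \<in> H #> r R" using r[OF R] rcos_self[OF g H] by (simp add: R_def)
    \<comment> \<open>With the factor from \<open>H\<close> on the left,
      \<open>translate_mult\<close> applies it to \<open>c\<close> first, where it acts as a scalar,
      leaving a multiple of \<open>b R\<close>.\<close>
    then obtain h where h: "h \<in> H" "g = h \<otimes> r R" by (auto simp: r_coset_def)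
    obtain k where k: "translate c h = fun_scale k c" using line[OF h(1)] by blast
    have "translate c g = fun_scale (inverse (\<alpha> h (r R))) (fun_scale k (b R))"
      using h HG r[OF R] by (simp add: translate_mult subset_iff k tmult_scale_left b_def)
    then show ?thesis
      using R by (simp add: fun_vs.span_scale fun_vs.span_base)
  qed
  moreover have "b ` (rcosets H) \<subseteq> fun_vs.span (translate c ` carrier G)"
    using r by (auto simp: b_def intro!: fun_vs.span_base)
  ultimately have "fun_vs.dim (c <#\<^bsub>A\<^esub> carrier A) = card (b ` (rcosets H))"
    unfolding l_coset_algebra
    by (intro fun_vs.dim_unique fun_vs.span_minimal fun_vs.subspace_span) auto
  also have "\<dots> = card (rcosets H)" using inj by (rule card_image)
  finally show ?thesis
    using lagrange[OF H] by (simp add: mult.commute)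
qed

end

theorem mainTheorem3:
  fixes G :: "('g, 'm) monoid_scheme"
    and \<alpha> :: "'g \<Rightarrow> 'g \<Rightarrow> 'k::{field, finite}"
    and C :: "('g \<Rightarrow> 'k) set"
  assumes "group G" and "finite (carrier G)" and "two_cocycle G \<alpha>"
    and "right_ideal C (twisted_group_algebra G \<alpha>)"
    and "C \<noteq> {\<zero>\<^bsub>twisted_group_algebra G \<alpha>\<^esub>}"
  shows "min_dist G C * fun_vs.dim C = order G \<longleftrightarrow>
    (\<exists>H c. subgroup H G \<and> c \<in> twisted_subalgebra H \<and>
       card H = min_dist G C \<and>
       fun_vs.dim (c <#\<^bsub>twisted_group_algebra G \<alpha>\<^esub> twisted_subalgebra H) = 1 \<and>
       C = c <#\<^bsub>twisted_group_algebra G \<alpha>\<^esub> carrier (twisted_group_algebra G \<alpha>))"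
proof -
  interpret twisted_group G \<alpha>
    using assms by (simp add: twisted_group_def twisted_group_axioms_def)
  have nonzero: "C \<noteq> {0}"
    using assms(5) by (simp add: twisted_group_algebra_def)
  show ?thesis
  proof
    assume "min_dist G C * fun_vs.dim C = order G"
    then show "\<exists>H c. subgroup H G \<and> c \<in> twisted_subalgebra H \<and> card H = min_dist G C \<and>
        fun_vs.dim (c <#\<^bsub>A\<^esub> twisted_subalgebra H) = 1 \<and> C = c <#\<^bsub>A\<^esub> carrier A"
      using line_if_extremal[OF assms(4) nonzero] by metis
  next
    assume "\<exists>H c. subgroup H G \<and> c \<in> twisted_subalgebra H \<and> card H = min_dist G C \<and>
        fun_vs.dim (c <#\<^bsub>A\<^esub> twisted_subalgebra H) = 1 \<and> C = c <#\<^bsub>A\<^esub> carrier A"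
    then obtain H c where Hc: "subgroup H G" "c \<in> twisted_subalgebra H"
      "card H = min_dist G C" "fun_vs.dim (c <#\<^bsub>A\<^esub> twisted_subalgebra H) = 1"
      "C = c <#\<^bsub>A\<^esub> carrier A"
      by blast
    \<comment> \<open>A zero generator would make \<open>C\<close> the zero code, which is
      excluded.\<close>
    have "c \<noteq> 0"
    proof
      assume "c = 0"
      then have "translate c g = 0" for g by (simp add: tmult_def fun_eq_iff)
      then have "C = {0}"
        unfolding Hc(5) l_coset_algebra using one_closed by (auto simp: image_constant_conv)
      then show False using nonzero by simp
    qed
    then show "min_dist G C * fun_vs.dim C = order G"
      using dim_if_line[OF Hc(1,2) _ Hc(4)] Hc(3,5) by simp
  qed
qed

end
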